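(* Let $P$ be the rectangular parallelepiped with its fixed partition into $n^3$ rectangular sub-domains $\Pi_I$ as in the context, let $D\subset\mathbb R^3$ be a bounded domain with $\overline D\cap\overline P=\varnothing$, and let $u_s\in C^\infty(\overline D)$. Assume $$k_0>\frac{\pi^2n^3}{2l},\qquad l=\min_{i=1,2,3}|b_i-a_i|.$$ If the integral equation of the first kind $$\int_P G(x,y)\,J(y)\,dy=u_s(x),\qquad x\in D,$$ has a piecewise constant solution $J=\sum_I J_I\chi_I$ with $J_I\in\mathbb C$, then this solution is the unique one in the class of such piecewise constant functions.
   Context: $P=\{x\in\mathbb R^3: a_j<x_j<b_j,\ j=1,2,3\}$ is an open rectangular parallelepiped. For a fixed integer $n\ge1$ set $x_{j,i}=a_j+\frac{b_j-a_j}{n}i$ ($0\le i\le n$), and for a multi-index $I=(i_1,i_2,i_3)$ with $0\le i_1,i_2,i_3\le n-1$ let $\Pi_I=\{x: x_{j,i_j}<x_j<x_{j,i_j+1},\ j=1,2,3\}$; $\chi_I$ is the indicator function of $\Pi_I$ (equal to $1$ on $\Pi_I$ and $0$ elsewhere). Piecewise constant functions are those of the form $\sum_I J_I\chi_I$ with coefficients $J_I\in\mathbb C$, for this fixed partition. $G(x,y)=\dfrac{e^{ik_0|x-y|}}{4\pi|x-y|}$ with $k_0>0$. A domain is a nonempty connected open set. *)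

theory Defs
  imports "HOL-Analysis.Analysis"
begin

definition partial_deriv :: "3 \<Rightarrow> (real^3 \<Rightarrow> complex) \<Rightarrow> real^3 \<Rightarrow> complex" where
  "partial_deriv j f x = vector_derivative (\<lambda>t. f (x + t *\<^sub>R axis j 1)) (at 0)"

fun iter_partial :: "3 list \<Rightarrow> (real^3 \<Rightarrow> complex) \<Rightarrow> real^3 \<Rightarrow> complex" where
  "iter_partial [] f = f"
| "iter_partial (j # js) f = partial_deriv j (iter_partial js f)"

text \<open>
  The space of smooth functions on the closure of an open set \<open>D\<close>: \<open>u\<close> is continuous on
  \<open>closure D\<close>, all its partial derivatives of all orders exist in \<open>D\<close>, and each of
  them has a continuous extension to \<open>closure D\<close> (hence is continuous in \<open>D\<close>). Values of
  \<open>u\<close> outside \<open>closure D\<close> are irrelevant.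
\<close>

definition smooth_on_closure :: "(real^3) set \<Rightarrow> (real^3 \<Rightarrow> complex) \<Rightarrow> bool" where
  "smooth_on_closure D u \<longleftrightarrow>
     continuous_on (closure D) u \<and>
     (\<forall>js. (\<forall>x\<in>D. \<forall>j. (\<lambda>t::real. iter_partial js u (x + t *\<^sub>R axis j 1)) differentiable (at 0)) \<and>
           (\<exists>g. continuous_on (closure D) g \<and> (\<forall>x\<in>D. g x = iter_partial js u x)))"

definition green :: "real \<Rightarrow> real^3 \<Rightarrow> real^3 \<Rightarrow> complex" where
  "green k0 x y =
     exp (\<i> * complex_of_real (k0 * norm (x - y))) / complex_of_real (4 * pi * norm (x - y))"

definition grid_node :: "real^3 \<Rightarrow> real^3 \<Rightarrow> nat \<Rightarrow> 3 \<Rightarrow> nat \<Rightarrow> real" where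
  "grid_node a b n j i = a $ j + (b $ j - a $ j) / real n * real i"

definition cell :: "real^3 \<Rightarrow> real^3 \<Rightarrow> nat \<Rightarrow> nat^3 \<Rightarrow> (real^3) set" where
  "cell a b n I =
     {x. \<forall>j. grid_node a b n j (I $ j) < x $ j \<and> x $ j < grid_node a b n j (I $ j + 1)}"

definition multi_indices :: "nat \<Rightarrow> (nat^3) set" where
  "multi_indices n = {I. \<forall>j. I $ j < n}"

lemma finite_multi_indices: "finite (multi_indices n)"
proof -
  have "finite {f :: 3 \<Rightarrow> nat. \<forall>j. f j \<in> {..<n}}"
    using finite_PiE[of "UNIV :: 3 set" "\<lambda>_. {..<n}"] by (simp add: PiE_UNIV_domain Pi_def)
  moreover have "multi_indices n \<subseteq> vec_lambda ` {f :: 3 \<Rightarrow> nat. \<forall>j. f j \<in> {..<n}}"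
  proof
    fix I assume "I \<in> multi_indices n"
    then have "vec_nth I \<in> {f. \<forall>j. f j \<in> {..<n}}" by (simp add: multi_indices_def)
    then show "I \<in> vec_lambda ` {f :: 3 \<Rightarrow> nat. \<forall>j. f j \<in> {..<n}}"
      by (metis image_eqI vec_nth_inverse)
  qed
  ultimately show ?thesis by (meson finite_imageI finite_subset)
qed

definition piecewise_constant :: "real^3 \<Rightarrow> real^3 \<Rightarrow> nat \<Rightarrow> (real^3 \<Rightarrow> complex) set" where
  "piecewise_constant a b n =
     {J. \<exists>c :: nat^3 \<Rightarrow> complex. J = (\<lambda>x. \<Sum>I\<in>multi_indices n. c I * indicator (cell a b n I) x)}"

text \<open>
  For \<open>J\<close> piecewise constant and \<open>closure D\<close> disjoint from the closed box, the integrand is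
  bounded and measurable, so the integral is a genuine one for every \<open>x \<in> D\<close>.
\<close>

definition solves_first_kind ::
  "real \<Rightarrow> (real^3) set \<Rightarrow> (real^3) set \<Rightarrow> (real^3 \<Rightarrow> complex) \<Rightarrow> (real^3 \<Rightarrow> complex) \<Rightarrow> bool" where
  "solves_first_kind k0 P D u J \<longleftrightarrow> (\<forall>x\<in>D. (LINT y:P|lborel. green k0 x y * J y) = u x)"

end

theory Submission
  imports Defs "HOL-Complex_Analysis.Conformal_Mappings"
begin

text \<open>
  The difference of two solutions has a potential vanishing on \<open>D\<close>. Fix \<open>x \<in> D\<close> and a hyperplane
  separating \<open>x\<close> from the closed box. Along every ray \<open>x + t \<nu>\<close> whose direction is close to its
  normal, the potential, suitably rescaled, extends holomorphically in \<open>s = 1 / t\<close> to a half-plane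
  containing \<open>0\<close>; it vanishes for large \<open>s\<close>, hence at \<open>s = 0\<close>, where it is the far field
  \<open>\<integral> exp (- i k \<nu> \<bullet> y) J(y) dy\<close>. So the far field vanishes on an open arc of some great circle
  \<open>cos \<theta> A + sin \<theta> B\<close>, and, being entire in \<open>\<theta>\<close>, also at \<open>\<theta> = i \<tau>\<close>. There the exponentials have
  modulus \<open>exp (k sinh \<tau> (B \<bullet> y))\<close>. The cells being translates of each other, a common nonzero
  factor splits off, and for generic \<open>B\<close> the remaining exponential sum has pairwise distinct growth
  rates, so all its coefficients vanish.
\<close>

section \<open>The spherical wave along a ray as a holomorphic function of the inverse
  distance\<close>

text \<open>On the nonpositive axis the imaginary part \<open>2 Im s (p + m Re s)\<close> vanishes,
  and its second factor is positive in this half-plane, so \<open>s\<close> is real. The value is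
  then \<open>(1 + p s)^2 + (m - p^2) s^2\<close>, and it is nonpositive only if
  \<open>s = - 1 / p = - p / m\<close>, a point on the excluded boundary. Hence the principal square
  root is holomorphic on the half-plane.\<close>

lemma ray_quadratic_not_nonpos:
  fixes p m :: real
  assumes "0 < p" "0 < m" "p\<^sup>2 \<le> m" "- (p / m) < Re s"
  shows "1 + 2 * of_real p * s + of_real m * s\<^sup>2 \<notin> \<real>\<^sub>\<le>\<^sub>0"
proof
  assume "1 + 2 * of_real p * s + of_real m * s\<^sup>2 \<in> \<real>\<^sub>\<le>\<^sub>0"
  then have im: "Im s * (p + m * Re s) = 0"
    and re: "1 + 2 * p * Re s + m * ((Re s)\<^sup>2 - (Im s)\<^sup>2) \<le> 0"
    by (auto simp: complex_nonpos_Reals_iff Re_power2 Im_power2 algebra_simps)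
  have pos: "0 < p + m * Re s"
    using assms by (simp add: field_simps)
  with im have "Im s = 0" by simp
  with re have "(1 + p * Re s)\<^sup>2 + (m - p\<^sup>2) * (Re s)\<^sup>2 \<le> 0"
    by (simp add: power2_eq_square algebra_simps)
  moreover have "0 \<le> (m - p\<^sup>2) * (Re s)\<^sup>2"
    using assms by simp
  ultimately have "1 + p * Re s = 0" and "(m - p\<^sup>2) * (Re s)\<^sup>2 = 0"
    by (smt (verit) zero_le_power2 power2_eq_iff zero_eq_power2)+
  then have "p * Re s = -1" "m = p\<^sup>2"
    by auto
  then have "p + m * Re s = p * (1 + p * Re s)"
    by (simp add: power2_eq_square algebra_simps)
  with \<open>1 + p * Re s = 0\<close> have "p + m * Re s = 0"
    by simp
  with pos show False by simp
qed

text \<open>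
  With \<open>p = \<nu> \<bullet> (x - y)\<close> and \<open>m = \<bar>x - y\<bar>\<^sup>2\<close> one has \<open>\<bar>x + \<nu> / s - y\<bar> = r / s\<close>. The quotient
  \<open>(2 p + m s) / (1 + r)\<close> equals \<open>(r - 1) / s\<close>, written so that it is regular at \<open>s = 0\<close>.
\<close>

definition ray_wave :: "real \<Rightarrow> real \<Rightarrow> real \<Rightarrow> complex \<Rightarrow> complex" where
  "ray_wave k p m s =
     (let r = csqrt (1 + 2 * of_real p * s + of_real m * s\<^sup>2)
      in exp (\<i> * of_real k * ((2 * of_real p + of_real m * s) / (1 + r))) / r)"

text \<open>Written out explicitly because differentiation under the integral sign needs the
  derivative to be jointly continuous in \<open>s\<close> and the integration variable;
  \<open>r'\<close> and \<open>e'\<close> are the derivatives of the root \<open>r\<close> and the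
  phase \<open>e\<close>.\<close>

definition ray_wave_deriv :: "real \<Rightarrow> real \<Rightarrow> real \<Rightarrow> complex \<Rightarrow> complex" where
  "ray_wave_deriv k p m s =
     (let r = csqrt (1 + 2 * of_real p * s + of_real m * s\<^sup>2);
          r' = (2 * of_real p + 2 * of_real m * s) / (2 * r);
          e = (2 * of_real p + of_real m * s) / (1 + r);
          e' = (of_real m * (1 + r) - (2 * of_real p + of_real m * s) * r') / ((1 + r) * (1 + r))
      in (exp (\<i> * of_real k * e) * (\<i> * of_real k * e') * r - exp (\<i> * of_real k * e) * r') / (r * r))"

text \<open>The principal root has nonnegative real part. This keeps the denominator of the phase in
  \<open>ray_wave\<close> away from zero.\<close>

lemma one_plus_csqrt_nonzero: "1 + csqrt z \<noteq> 0"
  using csqrt_principal[of z] by (auto simp: complex_eq_iff simp del: csqrt.sel)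

lemma has_field_derivative_ray_wave:
  assumes "1 + 2 * of_real p * s + of_real m * s\<^sup>2 \<notin> \<real>\<^sub>\<le>\<^sub>0"
  shows "(ray_wave k p m has_field_derivative ray_wave_deriv k p m s) (at s within U)"
proof -
  let ?q = "\<lambda>s. 1 + 2 * of_real p * s + of_real m * s\<^sup>2 :: complex"
  have 0: "csqrt (?q s) \<noteq> 0"
    using assms by auto
  have r: "((\<lambda>s. csqrt (?q s)) has_field_derivative
     (2 * of_real p + 2 * of_real m * s) / (2 * csqrt (?q s))) (at s within U)"
    using assms by (auto intro!: derivative_eq_intros)
  have e: "((\<lambda>s. (2 * of_real p + of_real m * s) / (1 + csqrt (?q s))) has_field_derivative
     (of_real m * (1 + csqrt (?q s)) - (2 * of_real p + of_real m * s) *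
        ((2 * of_real p + 2 * of_real m * s) / (2 * csqrt (?q s))))
      / ((1 + csqrt (?q s)) * (1 + csqrt (?q s)))) (at s within U)"
    by (rule derivative_eq_intros r refl one_plus_csqrt_nonzero)+ simp
  show ?thesis
    unfolding ray_wave_def ray_wave_deriv_def Let_def
    by (rule derivative_eq_intros r e refl 0)+ simp
qed

lemma continuous_on_ray_wave_deriv:
  fixes p m :: "'b::topological_space \<Rightarrow> real"
  assumes [continuous_intros]: "continuous_on X p" "continuous_on X m" "continuous_on X s"
    and q: "\<And>x. x \<in> X \<Longrightarrow> 1 + 2 * of_real (p x) * s x + of_real (m x) * (s x)\<^sup>2 \<notin> \<real>\<^sub>\<le>\<^sub>0"
  shows "continuous_on X (\<lambda>x. ray_wave_deriv k (p x) (m x) (s x))"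
proof -
  let ?r = "\<lambda>x. csqrt (1 + 2 * of_real (p x) * s x + of_real (m x) * (s x)\<^sup>2)"
  have [continuous_intros]: "continuous_on X ?r"
    by (rule continuous_on_compose2[OF continuous_on_csqrt])
      (use q in \<open>auto intro!: continuous_intros\<close>)
  have 0: "?r x \<noteq> 0" if "x \<in> X" for x
    using q[OF that] by auto
  show ?thesis
    unfolding ray_wave_deriv_def Let_def
    by (intro continuous_intros ballI) (use 0 in \<open>auto simp: one_plus_csqrt_nonzero\<close>)
qed

lemma continuous_on_ray_wave:
  fixes p m :: "'b::topological_space \<Rightarrow> real"
  assumes [continuous_intros]: "continuous_on X p" "continuous_on X m"
    and q: "\<And>x. x \<in> X \<Longrightarrow> 1 + 2 * of_real (p x) * s + of_real (m x) * s\<^sup>2 \<notin> \<real>\<^sub>\<le>\<^sub>0"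
  shows "continuous_on X (\<lambda>x. ray_wave k (p x) (m x) s)"
proof -
  let ?r = "\<lambda>x. csqrt (1 + 2 * of_real (p x) * s + of_real (m x) * s\<^sup>2)"
  have [continuous_intros]: "continuous_on X ?r"
    by (rule continuous_on_compose2[OF continuous_on_csqrt])
      (use q in \<open>auto intro!: continuous_intros\<close>)
  have 0: "?r x \<noteq> 0" if "x \<in> X" for x
    using q[OF that] by auto
  show ?thesis
    unfolding ray_wave_def Let_def
    by (intro continuous_intros ballI) (use 0 in \<open>auto simp: one_plus_csqrt_nonzero\<close>)
qed

text \<open>With the distance written as \<open>R / s\<close>, the phase \<open>k R / s\<close>
  splits into \<open>k / s\<close>, which is singular at \<open>s = 0\<close> but independent of
  \<open>y\<close>, and \<open>k (R - 1) / s\<close>, which is regular there. Only the second part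
  enters \<open>ray_wave\<close>.\<close>

lemma green_along_ray:
  assumes \<nu>: "norm \<nu> = 1" and s: "0 < s" and p: "0 < \<nu> \<bullet> (x - y)"
  shows "green k (x + (1 / s) *\<^sub>R \<nu>) y =
    of_real s * exp (\<i> * of_real (k / s)) / of_real (4 * pi) *
      ray_wave k (\<nu> \<bullet> (x - y)) ((norm (x - y))\<^sup>2) (of_real s)"
proof -
  define P where "P = \<nu> \<bullet> (x - y)"
  define M where "M = (norm (x - y))\<^sup>2"
  define R where "R = sqrt (1 + 2 * P * s + M * s\<^sup>2)"
  have q: "0 < 1 + 2 * P * s + M * s\<^sup>2"
    using p s by (auto simp: P_def M_def intro!: add_pos_nonneg)
  have R0: "0 < R" and R2: "R\<^sup>2 = 1 + 2 * P * s + M * s\<^sup>2"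
    using q by (auto simp: R_def)
  have c: "csqrt (1 + 2 * of_real P * of_real s + of_real M * (of_real s)\<^sup>2) = of_real R"
  proof -
    have "csqrt (of_real (1 + 2 * P * s + M * s\<^sup>2)) = of_real R"
      unfolding R_def using q by (intro of_real_sqrt[symmetric]) simp
    then show ?thesis
      by simp
  qed
  have "(norm (x + (1 / s) *\<^sub>R \<nu> - y))\<^sup>2 = (R / s)\<^sup>2"
  proof -
    have "(norm (x + (1 / s) *\<^sub>R \<nu> - y))\<^sup>2 = (norm ((x - y) + (1 / s) *\<^sub>R \<nu>))\<^sup>2"
      by (simp add: algebra_simps)
    also have "\<dots> = M + 2 * P / s + 1 / s\<^sup>2"
      unfolding power2_norm_eq_inner M_def P_def using \<nu>
      by (simp add: inner_add_left inner_add_right inner_commute norm_eq_1 power2_eq_square)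
    also have "\<dots> = (R / s)\<^sup>2"
      unfolding power_divide R2 using s by (simp add: field_simps power2_eq_square)
    finally show ?thesis .
  qed
  then have d: "norm (x + (1 / s) *\<^sub>R \<nu> - y) = R / s"
    using R0 s by (simp add: power2_eq_iff_nonneg)
  have "s * (2 * P + M * s) = (R - 1) * (1 + R)"
    using R2 by (simp add: algebra_simps power2_eq_square)
  then have "(2 * P + M * s) / (1 + R) = (R - 1) / s"
    using R0 s by (simp add: field_simps)
  then have e: "k * (R / s) = k / s + k * ((2 * P + M * s) / (1 + R))"
    by (simp add: diff_divide_distrib right_diff_distrib)
  have "ray_wave k P M (of_real s) =
      exp (\<i> * of_real (k * ((2 * P + M * s) / (1 + R)))) / of_real R"
    unfolding ray_wave_def Let_def c by (simp add: mult.assoc)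
  moreover have "exp (\<i> * of_real (k * (R / s))) =
      exp (\<i> * of_real (k / s)) * exp (\<i> * of_real (k * ((2 * P + M * s) / (1 + R))))"
    unfolding e of_real_add distrib_left exp_add ..
  ultimately show ?thesis
    unfolding green_def d P_def[symmetric] M_def[symmetric]
    using s R0 by simp
qed

section \<open>From vanishing near a point to vanishing of the far field\<close>

lemma islimpt_of_real_image:
  "x islimpt A \<Longrightarrow> (of_real x :: complex) islimpt of_real ` A"
  unfolding islimpt_approachable by (auto simp: dist_of_real)

text \<open>Points of the ray near \<open>x\<close> correspond to large \<open>s = 1 / t\<close>,
  and infinity to \<open>s = 0\<close>. The uniform gap \<epsilon> keeps the branch points for all
  \<open>y\<close> to the left of one vertical line with negative abscissa, so a single half-plane
  serves in the identity theorem.\<close>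

lemma far_field_zero:
  fixes lo hi :: "'i \<Rightarrow> real^3"
  assumes \<nu>: "norm \<nu> = 1" and \<epsilon>: "0 < \<epsilon>"
    and sep: "\<And>i y. i \<in> S \<Longrightarrow> y \<in> cbox (lo i) (hi i) \<Longrightarrow> \<epsilon> \<le> \<nu> \<bullet> (x - y)"
    and S: "finite S" and \<delta>: "0 < \<delta>"
    and zero: "\<And>t. 0 < t \<Longrightarrow> t < \<delta> \<Longrightarrow>
      (\<Sum>i\<in>S. c i * integral (cbox (lo i) (hi i)) (green k (x + t *\<^sub>R \<nu>))) = 0"
  shows "(\<Sum>i\<in>S. c i * integral (cbox (lo i) (hi i)) (\<lambda>y. exp (- \<i> * of_real (k * (\<nu> \<bullet> y))))) = 0"
proof -
  have "bounded (\<Union>i\<in>S. cbox (lo i) (hi i))"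
    using S by auto
  then obtain K where K: "\<And>i y. i \<in> S \<Longrightarrow> y \<in> cbox (lo i) (hi i) \<Longrightarrow> norm y \<le> K"
    unfolding bounded_iff by blast
  \<comment> \<open>An upper bound for the squared distance from \<open>x\<close> to all boxes; the
    summand 1 makes it positive.\<close>
  define M where "M = (norm x + \<bar>K\<bar> + 1)\<^sup>2"
  have M0: "0 < M" unfolding M_def by (smt (verit) norm_ge_zero zero_less_power)
  \<comment> \<open>Since \<open>\<epsilon> / M \<le> p / m\<close> for every \<open>y\<close>, this
    half-plane lies in all the half-planes of \<open>ray_quadratic_not_nonpos\<close>.\<close>
  define U where "U = {s. - (\<epsilon> / M) < Re s}"
  have U: "open U" "convex U"
    unfolding U_def by (auto simp: open_halfspace_Re_gt convex_halfspace_Re_gt)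
  let ?p = "\<lambda>y. \<nu> \<bullet> (x - y)" and ?m = "\<lambda>y. (norm (x - y))\<^sup>2"
  have q: "1 + 2 * of_real (?p y) * s + of_real (?m y) * s\<^sup>2 \<notin> \<real>\<^sub>\<le>\<^sub>0"
    if "i \<in> S" "y \<in> cbox (lo i) (hi i)" "s \<in> U" for i y s
  proof (rule ray_quadratic_not_nonpos)
    show p: "0 < ?p y"
      using sep[OF that(1,2)] \<epsilon> by linarith
    then show m: "0 < ?m y"
      by auto
    show "(?p y)\<^sup>2 \<le> ?m y"
      using Cauchy_Schwarz_ineq[of \<nu> "x - y"] \<nu> by (simp add: power2_norm_eq_inner norm_eq_1)
    have "norm (x - y) \<le> norm x + \<bar>K\<bar> + 1"
      using norm_triangle_ineq4[of x y] K[OF that(1,2)] by linarith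
    then have "?m y \<le> M"
      unfolding M_def by (intro power_mono) auto
    then have "\<epsilon> / M \<le> ?p y / ?m y"
      using sep[OF that(1,2)] m p by (intro frac_le) auto
    then show "- (?p y / ?m y) < Re s"
      using that(3) by (simp add: U_def)
  qed
  define H where "H s = (\<Sum>i\<in>S. c i * integral (cbox (lo i) (hi i)) (\<lambda>y. ray_wave k (?p y) (?m y) s))" for s
  have "H holomorphic_on U"
    unfolding H_def
  proof (intro holomorphic_intros leibniz_rule_holomorphic[where fx = "\<lambda>s y. ray_wave_deriv k (?p y) (?m y) s"])
    fix i assume i: "i \<in> S"
    show "((\<lambda>s. ray_wave k (?p y) (?m y) s) has_field_derivative ray_wave_deriv k (?p y) (?m y) s) (at s within U)"
      if "s \<in> U" "y \<in> cbox (lo i) (hi i)" for s y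
      using has_field_derivative_ray_wave[OF q[OF i that(2,1)]] .
    show "(\<lambda>y. ray_wave k (?p y) (?m y) s) integrable_on cbox (lo i) (hi i)" if "s \<in> U" for s
      using q[OF i _ that] by (intro integrable_continuous continuous_on_ray_wave continuous_intros) auto
    show "continuous_on (U \<times> cbox (lo i) (hi i)) (\<lambda>(s, y). ray_wave_deriv k (?p y) (?m y) s)"
      unfolding case_prod_beta using q[OF i]
      by (intro continuous_on_ray_wave_deriv continuous_intros) auto
  qed (use U in auto)
  moreover have "H z = 0" if "z \<in> of_real ` {1 / \<delta><..}" for z
  proof -
    from that obtain s where s: "z = of_real s" "1 / \<delta> < s" by auto
    then have "0 < s" using \<delta> by (meson less_trans zero_less_divide_1_iff)
    have "1 / s < \<delta>" using s \<delta> \<open>0 < s\<close> by (simp add: field_simps)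
    \<comment> \<open>This prefactor is nonzero and the same for all boxes, so it can be cancelled
      from the vanishing potential.\<close>
    define C where "C = of_real s * exp (\<i> * of_real (k / s)) / of_real (4 * pi)"
    have "integral (cbox (lo i) (hi i)) (green k (x + (1 / s) *\<^sub>R \<nu>)) =
        C * integral (cbox (lo i) (hi i)) (\<lambda>y. ray_wave k (?p y) (?m y) z)" if "i \<in> S" for i
    proof -
      have "integral (cbox (lo i) (hi i)) (green k (x + (1 / s) *\<^sub>R \<nu>)) =
        integral (cbox (lo i) (hi i)) (\<lambda>y. C * ray_wave k (?p y) (?m y) z)"
        unfolding C_def s(1)
        using sep[OF that] \<epsilon>
        by (intro integral_cong green_along_ray \<nu> \<open>0 < s\<close>) (auto intro: less_le_trans)
      then show ?thesis by simp
    qed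
    then have "C * H z = (\<Sum>i\<in>S. c i * integral (cbox (lo i) (hi i)) (green k (x + (1 / s) *\<^sub>R \<nu>)))"
      unfolding H_def sum_distrib_left by (intro sum.cong refl) simp
    also have "\<dots> = 0"
      using \<open>0 < s\<close> \<open>1 / s < \<delta>\<close> by (intro zero) auto
    finally show ?thesis
      using \<open>0 < s\<close> by (simp add: C_def)
  qed
  moreover have "(of_real (2 / \<delta>) :: complex) islimpt of_real ` {1 / \<delta><..}"
    using \<delta> by (intro islimpt_of_real_image interior_limit_point) (simp add: interior_open field_simps)
  moreover have "of_real ` {1 / \<delta><..} \<subseteq> U" "of_real (2 / \<delta>) \<in> U" "0 \<in> U"
  proof -
    have "- (\<epsilon> / M) < 0" using \<epsilon> M0 by simp
    moreover have "0 < 1 / \<delta>" "0 < 2 / \<delta>" using \<delta> by auto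
    ultimately have "- (\<epsilon> / M) < t" if "1 / \<delta> < t" for t using that by linarith
    then show "of_real ` {1 / \<delta><..} \<subseteq> U" by (auto simp: U_def)
    have "- (\<epsilon> / M) < 2 / \<delta>"
      using \<open>0 < 2 / \<delta>\<close> \<open>- (\<epsilon> / M) < 0\<close> by linarith
    then show "of_real (2 / \<delta>) \<in> U" "0 \<in> U"
      unfolding U_def using \<open>- (\<epsilon> / M) < 0\<close> by (simp_all del: of_real_divide)
  qed
  ultimately have H0: "H 0 = 0"
    using analytic_continuation[of H U "of_real ` {1 / \<delta><..}" "of_real (2 / \<delta>)" 0] U
    by (simp add: convex_connected)
  \<comment> \<open>At \<open>s = 0\<close> the root is 1 and the phase is
    \<open>2 p / 2 = p\<close>; the part of it that depends on \<open>x\<close> is a nonzero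
    constant factor.\<close>
  have "ray_wave k p m 0 = exp (\<i> * of_real (k * p))" for p m
    by (simp add: ray_wave_def)
  then have "ray_wave k (?p y) (?m y) 0 = exp (\<i> * of_real (k * (\<nu> \<bullet> x))) * exp (- \<i> * of_real (k * (\<nu> \<bullet> y)))" for y
    by (simp add: inner_diff_right right_diff_distrib flip: exp_add)
  then have "H 0 = exp (\<i> * of_real (k * (\<nu> \<bullet> x))) *
    (\<Sum>i\<in>S. c i * integral (cbox (lo i) (hi i)) (\<lambda>y. exp (- \<i> * of_real (k * (\<nu> \<bullet> y)))))"
    by (simp only: H_def integral_mult_right sum_distrib_left mult.left_commute)
  with H0 show ?thesis by simp
qed

section \<open>Continuation of the far field to complex directions\<close>

text \<open>The sum is entire in \<theta> and vanishes on a real interval, hence everywhere. At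
  \<open>\<theta> = i \<tau>\<close> the cosine becomes \<open>cosh \<tau>\<close> and the sine
  \<open>i sinh \<tau>\<close>, so the \<open>B\<close> component turns from oscillation into real
  exponential growth.\<close>

lemma far_field_complexify:
  fixes lo hi :: "'i \<Rightarrow> 'a::euclidean_space"
  assumes \<eta>: "0 < \<eta>"
    and zero: "\<And>\<theta>. \<bar>\<theta>\<bar> < \<eta> \<Longrightarrow>
      (\<Sum>i\<in>S. c i * integral (cbox (lo i) (hi i))
        (\<lambda>y. exp (- \<i> * of_real (k * ((cos \<theta> *\<^sub>R A + sin \<theta> *\<^sub>R B) \<bullet> y))))) = 0"
  shows "(\<Sum>i\<in>S. c i * integral (cbox (lo i) (hi i))
      (\<lambda>y. exp (of_real (k * sinh \<tau> * (B \<bullet> y)) - \<i> * of_real (k * cosh \<tau> * (A \<bullet> y))))) = 0"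
proof -
  define f where "f = (\<lambda>\<theta> y. exp (- \<i> * of_real k * (cos \<theta> * of_real (A \<bullet> y) + sin \<theta> * of_real (B \<bullet> y))))"
  define H where "H \<theta> = (\<Sum>i\<in>S. c i * integral (cbox (lo i) (hi i)) (f \<theta>))" for \<theta>
  have "H holomorphic_on UNIV"
    unfolding H_def
  proof (intro holomorphic_intros leibniz_rule_holomorphic)
    show "((\<lambda>\<theta>. f \<theta> y) has_field_derivative
        f \<theta> y * (- \<i> * of_real k * (- sin \<theta> * of_real (A \<bullet> y) + cos \<theta> * of_real (B \<bullet> y)))) (at \<theta> within UNIV)" for \<theta> y
      unfolding f_def by (auto intro!: derivative_eq_intros)
    show "f \<theta> integrable_on cbox a b" for \<theta> a b
      unfolding f_def by (intro integrable_continuous continuous_intros)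
    show "continuous_on (UNIV \<times> cbox a b) (\<lambda>(\<theta>, y). f \<theta> y * (- \<i> * of_real k * (- sin \<theta> * of_real (A \<bullet> y) + cos \<theta> * of_real (B \<bullet> y))))" for a b
      unfolding f_def case_prod_beta by (intro continuous_intros)
  qed auto
  moreover have "H z = 0" if "z \<in> of_real ` {-\<eta><..<\<eta>}" for z
  proof -
    from that obtain \<theta> where \<theta>: "z = of_real \<theta>" "\<bar>\<theta>\<bar> < \<eta>" by auto
    have "f z = (\<lambda>y. exp (- \<i> * of_real (k * ((cos \<theta> *\<^sub>R A + sin \<theta> *\<^sub>R B) \<bullet> y))))"
      unfolding f_def \<theta>(1) by (auto simp: inner_add_left cos_of_real sin_of_real algebra_simps)
    with zero[OF \<theta>(2)] show ?thesis
      by (simp add: H_def)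
  qed
  moreover have "(of_real 0 :: complex) islimpt of_real ` {-\<eta><..<\<eta>}"
    using \<eta> by (intro islimpt_of_real_image interior_limit_point) (simp add: interior_open)
  ultimately have "H (\<i> * of_real \<tau>) = 0"
    using analytic_continuation[of H UNIV "of_real ` {-\<eta><..<\<eta>}" "of_real 0"] by auto
  moreover have "f (\<i> * of_real \<tau>) =
      (\<lambda>y. exp (of_real (k * sinh \<tau> * (B \<bullet> y)) - \<i> * of_real (k * cosh \<tau> * (A \<bullet> y))))"
  proof -
    have "cos (\<i> * of_real \<tau>) = of_real (cosh \<tau>)" "sin (\<i> * of_real \<tau>) = \<i> * of_real (sinh \<tau>)"
      by (simp_all add: cos_i_times sin_i_times cosh_field_def sinh_field_def exp_minus exp_of_real)
    then show ?thesis
      unfolding f_def by (simp add: algebra_simps)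
  qed
  ultimately show ?thesis
    by (simp add: H_def)
qed

section \<open>Integrals of exponentials over a box\<close>

text \<open>The integral is \<open>(exp (lam h) - 1) / lam\<close>, and the modulus of
  \<open>exp (lam h)\<close> is \<open>exp (h Re lam)\<close>, which differs from 1. For imaginary
  \<open>lam\<close>, such as \<open>2 pi i / h\<close>, it could vanish.\<close>

lemma integral_exp_linear_nonzero:
  fixes lam :: complex and h :: real
  assumes "Re lam \<noteq> 0" "0 < h"
  shows "integral {0..h} (\<lambda>t. exp (lam * of_real t)) \<noteq> 0"
proof -
  have [simp]: "lam \<noteq> 0" using assms by auto
  have "((\<lambda>t. exp (lam * of_real t)) has_integral exp (lam * of_real h) / lam - exp (lam * of_real 0) / lam) {0..h}"
    using assms
    by (intro fundamental_theorem_of_calculus)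
      (auto intro!: derivative_eq_intros has_vector_derivative_real_field)
  moreover have "exp (lam * of_real h) \<noteq> 1"
  proof
    assume "exp (lam * of_real h) = 1"
    then have "norm (exp (lam * of_real h)) = 1" by simp
    then show False using assms by simp
  qed
  ultimately show ?thesis
    by (auto simp: has_integral_iff simp flip: diff_divide_distrib)
qed

text \<open>Fubini for a product of functions of single coordinates: \<open>lborel\<close> is the
  image of the product measure over \<open>Basis\<close> under the map from coordinates to
  vectors.\<close>

lemma lebesgue_integral_prod_Basis:
  fixes f :: "'a::euclidean_space \<Rightarrow> real \<Rightarrow> complex"
  assumes int: "\<And>b. b \<in> Basis \<Longrightarrow> integrable lborel (f b)"
  shows "(LINT x|lborel. (\<Prod>b\<in>Basis. f b (x \<bullet> b))) = (\<Prod>b\<in>Basis. LINT t|lborel. f b t)"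
proof -
  interpret product_sigma_finite "\<lambda>_::'a. lborel :: real measure" ..
  have [measurable]: "f b \<in> borel_measurable borel" if "b \<in> Basis" for b
    using borel_measurable_integrable[OF int[OF that]] by simp
  have "(LINT x|lborel. (\<Prod>b\<in>Basis. f b (x \<bullet> b))) =
      (LINT g|(\<Pi>\<^sub>M b\<in>Basis. lborel). (\<Prod>b\<in>Basis. f b ((\<Sum>b\<in>Basis. g b *\<^sub>R b) \<bullet> b)))"
    unfolding lborel_eq[where 'a='a] by (rule integral_distr) measurable
  also have "\<dots> = (LINT g|(\<Pi>\<^sub>M b\<in>Basis. lborel). (\<Prod>b\<in>Basis. f b (g b)))"
    by (intro Bochner_Integration.integral_cong prod.cong refl) (simp add: inner_sum_left_Basis)
  also have "\<dots> = (\<Prod>b\<in>Basis. LINT t|lborel. f b t)"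
    by (rule product_integral_prod) (auto intro: int)
  finally show ?thesis .
qed

text \<open>Both the exponential and the indicator of the box factor over the coordinates, so the
  integral is a product of nonzero one-dimensional integrals.\<close>

lemma integral_cbox_exp_linear_nonzero:
  fixes lam :: "'a::euclidean_space \<Rightarrow> complex" and h :: 'a
  assumes lam: "\<And>b. b \<in> Basis \<Longrightarrow> Re (lam b) \<noteq> 0" and h: "\<And>b. b \<in> Basis \<Longrightarrow> 0 < h \<bullet> b"
  shows "integral (cbox 0 h) (\<lambda>y. exp (\<Sum>b\<in>Basis. lam b * of_real (y \<bullet> b))) \<noteq> 0"
proof -
  define f where "f b t = indicator {0..h \<bullet> b} t *\<^sub>R exp (lam b * of_real t)" for b t
  have int1: "integrable lborel (f b)" for b
    unfolding f_def by (intro borel_integrable_compact continuous_intros) auto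
  have int: "set_integrable lborel (cbox 0 h) (\<lambda>y. exp (\<Sum>b\<in>Basis. lam b * of_real (y \<bullet> b)))"
    unfolding set_integrable_def by (intro borel_integrable_compact continuous_intros) auto
  have "integral (cbox 0 h) (\<lambda>y. exp (\<Sum>b\<in>Basis. lam b * of_real (y \<bullet> b))) =
      (LINT y:cbox 0 h|lborel. exp (\<Sum>b\<in>Basis. lam b * of_real (y \<bullet> b)))"
    using set_borel_integral_eq_integral(2)[OF int] by simp
  also have "\<dots> = (LINT y|lborel. (\<Prod>b\<in>Basis. f b (y \<bullet> b)))"
    unfolding set_lebesgue_integral_def
  proof (intro Bochner_Integration.integral_cong refl)
    fix y :: 'a
    show "indicator (cbox 0 h) y *\<^sub>R exp (\<Sum>b\<in>Basis. lam b * of_real (y \<bullet> b)) = (\<Prod>b\<in>Basis. f b (y \<bullet> b))"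
    proof (cases "y \<in> cbox 0 h")
      case True
      then have "f b (y \<bullet> b) = exp (lam b * of_real (y \<bullet> b))" if "b \<in> Basis" for b
        using that by (auto simp: f_def mem_box)
      then show ?thesis using True by (simp add: exp_sum)
    next
      case False
      then obtain b where "b \<in> Basis" "y \<bullet> b \<notin> {0..h \<bullet> b}"
        by (auto simp: mem_box)
      then have "\<exists>b\<in>Basis. f b (y \<bullet> b) = 0"
        by (intro bexI[of _ b]) (auto simp: f_def)
      then show ?thesis using False by (simp add: prod_zero)
    qed
  qed
  also have "\<dots> = (\<Prod>b\<in>Basis. LINT t|lborel. f b t)"
    by (rule lebesgue_integral_prod_Basis[OF int1])
  also have "\<dots> \<noteq> 0"
  proof -
    have "(LINT t|lborel. f b t) \<noteq> 0" if "b \<in> Basis" for b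
    proof -
      have "(LINT t|lborel. f b t) = integral {0..h \<bullet> b} (\<lambda>t. exp (lam b * of_real t))"
        using int1[of b] unfolding f_def
        by (subst set_borel_integral_eq_integral(2)[symmetric])
          (simp_all add: set_integrable_def set_lebesgue_integral_def)
      then show ?thesis
        using integral_exp_linear_nonzero[OF lam[OF that] h[OF that]] by simp
    qed
    then show ?thesis by simp
  qed
  finally show ?thesis .
qed

section \<open>Exponential sums with distinct growth rates, and generic directions\<close>

text \<open>Among the terms with nonzero coefficient the fastest one dominates: after division by
  its modulus all others tend to 0 as \<sigma> grows. Only the moduli of the terms are prescribed;
  their phases may vary with \<sigma> in any way.\<close>

lemma exponential_sum_coeffs_zero:
  fixes \<mu> :: "'i \<Rightarrow> real" and c :: "'i \<Rightarrow> complex"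
  assumes "finite S" "inj_on \<mu> S"
    and growth: "\<And>\<sigma> i. 0 < \<sigma> \<Longrightarrow> i \<in> S \<Longrightarrow> norm (z \<sigma> i) = exp (\<sigma> * \<mu> i)"
    and zero: "\<And>\<sigma>. 0 < \<sigma> \<Longrightarrow> (\<Sum>i\<in>S. c i * z \<sigma> i) = 0"
    and "i \<in> S"
  shows "c i = 0"
proof (rule ccontr)
  assume "c i \<noteq> 0"
  define T where "T = {i \<in> S. c i \<noteq> 0}"
  have T: "finite T" "T \<noteq> {}" "T \<subseteq> S"
    using assms \<open>c i \<noteq> 0\<close> by (auto simp: T_def)
  \<comment> \<open>The minimiser of \<open>- \<mu>\<close> has the largest growth rate; injectivity
    of \<mu> makes this maximum strict.\<close>
  define j where "j = (ARG_MIN (\<lambda>i. - \<mu> i) i. i \<in> T)"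
  have j: "j \<in> T" and max: "\<And>i. i \<in> T \<Longrightarrow> \<mu> i \<le> \<mu> j"
    using arg_min_if_finite[OF T(1,2), of "\<lambda>i. - \<mu> i"] unfolding j_def arg_min_on_def
    by (auto simp: not_less)
  have lt: "\<mu> i < \<mu> j" if "i \<in> T - {j}" for i
  proof -
    have "\<mu> i \<le> \<mu> j" "\<mu> i \<noteq> \<mu> j"
      using that j T(3) max[of i] inj_onD[OF assms(2), of i j] by auto
    then show ?thesis by simp
  qed
  have bound: "norm (c j) \<le> (\<Sum>i\<in>T-{j}. norm (c i) * exp (\<sigma> * (\<mu> i - \<mu> j)))" if "0 < \<sigma>" for \<sigma>
  proof -
    have "(\<Sum>i\<in>T. c i * z \<sigma> i) = 0"
      using zero[OF that] assms(1) by (subst sum.mono_neutral_left[of S]) (auto simp: T_def)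
    then have "c j * z \<sigma> j = - (\<Sum>i\<in>T-{j}. c i * z \<sigma> i)"
      using sum.remove[OF T(1) j, of "\<lambda>i. c i * z \<sigma> i"] by (simp only: eq_neg_iff_add_eq_0)
    then have "norm (c j * z \<sigma> j) \<le> (\<Sum>i\<in>T-{j}. norm (c i * z \<sigma> i))"
      by (simp only: norm_minus_cancel norm_sum)
    also have "\<dots> = (\<Sum>i\<in>T-{j}. norm (c i) * exp (\<sigma> * \<mu> i))"
      using T(3) that by (intro sum.cong refl) (auto simp: norm_mult growth)
    finally have "norm (c j) * exp (\<sigma> * \<mu> j) \<le> (\<Sum>i\<in>T-{j}. norm (c i) * exp (\<sigma> * \<mu> i))"
      using T(3) j that by (simp add: norm_mult growth subsetD)
    then have "norm (c j) \<le> (\<Sum>i\<in>T-{j}. norm (c i) * exp (\<sigma> * \<mu> i)) / exp (\<sigma> * \<mu> j)"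
      by (simp add: pos_le_divide_eq)
    then show ?thesis
      by (simp add: sum_divide_distrib right_diff_distrib exp_diff)
  qed
  have "((\<lambda>\<sigma>. \<Sum>i\<in>T-{j}. norm (c i) * exp (\<sigma> * (\<mu> i - \<mu> j))) \<longlongrightarrow> (\<Sum>i\<in>T-{j}. norm (c i) * 0)) at_top"
  proof (intro tendsto_sum tendsto_mult tendsto_const)
    fix i assume "i \<in> T - {j}"
    then have "filterlim (\<lambda>\<sigma>. (\<mu> i - \<mu> j) * \<sigma>) at_bot at_top"
      using lt[of i] by (intro filterlim_tendsto_neg_mult_at_bot[OF tendsto_const _ filterlim_ident]) auto
    then have "filterlim (\<lambda>\<sigma>. \<sigma> * (\<mu> i - \<mu> j)) at_bot at_top"
      by (subst mult.commute)
    then show "((\<lambda>\<sigma>. exp (\<sigma> * (\<mu> i - \<mu> j))) \<longlongrightarrow> 0) at_top"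
      by (rule filterlim_compose[OF exp_at_bot])
  qed
  then have "norm (c j) \<le> (\<Sum>i\<in>T-{j}. norm (c i) * 0)"
    by (rule tendsto_lowerbound) (auto intro: bound eventually_mono[OF eventually_gt_at_top[of 0]])
  then show False
    using j by (simp add: T_def)
qed

text \<open>The vector under the norm is the projection of \<open>v\<close> onto the line of
  \<open>w\<close>. It vanishes for \<open>w = e\<close> orthogonal to \<open>v\<close>, so it is
  small near \<open>e\<close>, and a neighbourhood of \<open>e\<close> is not covered by finitely
  many hyperplanes. Exact orthogonality cannot be asked for, since some \<open>d\<close> may be
  parallel to \<open>v\<close>.\<close>

lemma generic_directions:
  fixes v :: "'a::euclidean_space"
  assumes dim: "2 \<le> DIM('a)" and \<epsilon>: "0 < \<epsilon>" and F: "finite F" "0 \<notin> F" and v: "v \<noteq> 0"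
  obtains w where "w \<noteq> 0" "norm (((v \<bullet> w) / (w \<bullet> w)) *\<^sub>R w) < \<epsilon>" "\<And>d. d \<in> F \<Longrightarrow> w \<bullet> d \<noteq> 0"
proof -
  obtain e where e: "e \<noteq> 0" "v \<bullet> e = 0"
    using orthogonal_to_vector_exists[OF dim, of v] by (auto simp: orthogonal_def)
  define g where "g w = norm (((v \<bullet> w) / (w \<bullet> w)) *\<^sub>R w)" for w
  have "isCont g e"
    unfolding g_def using e by (intro continuous_intros) auto
  then have "(g \<longlongrightarrow> g e) (nhds e)"
    unfolding isCont_def tendsto_at_iff_tendsto_nhds .
  then have "eventually (\<lambda>w. g w < \<epsilon>) (nhds e)"
    using \<epsilon> e by (intro order_tendstoD(2)[of g "g e"]) (auto simp: g_def)
  moreover have "eventually (\<lambda>w. w \<noteq> 0) (nhds e)"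
    using e by (intro t1_space_nhds) auto
  ultimately have "eventually (\<lambda>w. w \<noteq> 0 \<and> g w < \<epsilon>) (nhds e)"
    by eventually_elim auto
  then obtain X where X: "open X" "e \<in> X" "\<And>w. w \<in> X \<Longrightarrow> w \<noteq> 0 \<and> g w < \<epsilon>"
    unfolding eventually_nhds by blast
  have "negligible (\<Union>d\<in>F. {w. d \<bullet> w = 0})"
    using F by (intro negligible_Union) (auto intro!: negligible_hyperplane)
  moreover have "\<not> negligible X"
    using X open_not_negligible by blast
  ultimately obtain w where "w \<in> X" "w \<notin> (\<Union>d\<in>F. {w. d \<bullet> w = 0})"
    using negligible_subset by blast
  with X(3)[of w] that[of w] show thesis
    by (auto simp: inner_commute g_def)
qed

section \<open>A potential vanishing on a ball forces the coefficients to vanish\<close>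

text \<open>All boxes are translates of one box with side vector \<open>h\<close>, so the integral
  of an exponential over each is its value at the corner times a common factor. What remains is an
  exponential sum over the corners.\<close>

lemma density_zero_if_potential_zero:
  fixes lo :: "'i \<Rightarrow> real^3"
  assumes S: "finite S" "inj_on lo S" and h: "\<And>j. 0 < h $ j" and k: "0 < k"
    and \<epsilon>: "0 < \<epsilon>"
    and sep: "\<And>i y. i \<in> S \<Longrightarrow> y \<in> cbox (lo i) (lo i + h) \<Longrightarrow> \<epsilon> \<le> v \<bullet> (x - y)"
    and r: "0 < r"
    and zero: "\<And>z. z \<in> ball x r \<Longrightarrow>
      (\<Sum>i\<in>S. c i * integral (cbox (lo i) (lo i + h)) (green k z)) = 0"
    and i: "i \<in> S"
  shows "c i = 0"
proof -
  have "bounded (\<Union>i\<in>S. (\<lambda>y. x - y) ` cbox (lo i) (lo i + h))"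
    using S by (intro bounded_UN ballI compact_imp_bounded compact_continuous_image continuous_intros) auto
  then obtain K where K: "0 < K" "\<And>i y. i \<in> S \<Longrightarrow> y \<in> cbox (lo i) (lo i + h) \<Longrightarrow> norm (x - y) \<le> K"
    unfolding bounded_pos by blast
  have lo: "lo i \<in> cbox (lo i) (lo i + h)" for i
    using h by (simp add: mem_box_cart less_imp_le)
  have hB: "0 < h \<bullet> b" if "b \<in> Basis" for b
    using that h by (auto simp: Basis_vec_def inner_axis)
  have v: "v \<noteq> 0"
    using sep[OF i lo] \<epsilon> by auto
  \<comment> \<open>Differences of corners are included to make the growth rates
    \<open>B \<bullet> lo i\<close> distinct, basis vectors to make the real parts of the exponents
    nonzero in every coordinate.\<close>
  define F where "F = (\<lambda>(i, j). lo i - lo j) ` {(i, j) \<in> S \<times> S. i \<noteq> j} \<union> Basis"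
  have "finite {(i, j) \<in> S \<times> S. i \<noteq> j}"
    by (rule finite_subset[of _ "S \<times> S"]) (use S(1) in auto)
  then have F: "finite F"
    by (simp add: F_def)
  have F0: "0 \<notin> F"
    using inj_onD[OF S(2)] nonzero_Basis by (fastforce simp: F_def)
  obtain w where w: "w \<noteq> 0" "norm (((v \<bullet> w) / (w \<bullet> w)) *\<^sub>R w) < \<epsilon> / (2 * K)"
      "\<And>d. d \<in> F \<Longrightarrow> w \<bullet> d \<noteq> 0"
    using generic_directions[OF _ _ F F0 v, of "\<epsilon> / (2 * K)"] \<epsilon> K by auto
  \<comment> \<open>Removing the projection makes \<open>A0\<close> orthogonal to \<open>w\<close>.
    The removed vector is shorter than \<open>\<epsilon> / (2 * K)\<close>, so at most half of the
    separation \<epsilon> is lost.\<close>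
  define A0 where "A0 = v - ((v \<bullet> w) / (w \<bullet> w)) *\<^sub>R w"
  have A0: "\<epsilon> / 2 \<le> A0 \<bullet> (x - y)" if "i \<in> S" "y \<in> cbox (lo i) (lo i + h)" for i y
  proof -
    have "(((v \<bullet> w) / (w \<bullet> w)) *\<^sub>R w) \<bullet> (x - y) \<le> norm (((v \<bullet> w) / (w \<bullet> w)) *\<^sub>R w) * norm (x - y)"
      by (rule norm_cauchy_schwarz)
    also have "\<dots> \<le> \<epsilon> / (2 * K) * K"
      using w(2) K \<epsilon> that by (intro mult_mono) auto
    finally show ?thesis
      using sep[OF that] K(1) by (simp add: A0_def inner_diff_left)
  qed
  have "A0 \<noteq> 0"
    using A0[OF i lo] \<epsilon> by auto
  define A where "A = A0 /\<^sub>R norm A0"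
  define B where "B = w /\<^sub>R norm w"
  have "A0 \<bullet> w = 0"
    using w(1) by (simp add: A0_def inner_diff_left)
  then have orth: "A \<bullet> B = 0" "B \<bullet> A = 0"
    by (simp_all add: A_def B_def inner_commute)
  have unit: "A \<bullet> A = 1" "B \<bullet> B = 1"
    unfolding norm_eq_1[symmetric] using w(1) \<open>A0 \<noteq> 0\<close> by (simp_all add: A_def B_def)
  define \<epsilon>' where "\<epsilon>' = \<epsilon> / 2 / norm A0"
  have \<epsilon>': "0 < \<epsilon>'"
    using \<epsilon> \<open>A0 \<noteq> 0\<close> by (simp add: \<epsilon>'_def)
  have A: "\<epsilon>' \<le> A \<bullet> (x - y)" if "i \<in> S" "y \<in> cbox (lo i) (lo i + h)" for i y
  proof -
    have "A \<bullet> (x - y) = A0 \<bullet> (x - y) / norm A0"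
      using \<open>A0 \<noteq> 0\<close> by (simp add: A_def field_simps)
    then show ?thesis
      unfolding \<epsilon>'_def using divide_right_mono[OF A0[OF that] norm_ge_zero] by simp
  qed
  \<comment> \<open>For small \<theta> this expression bounds \<open>\<nu> \<bullet> (x - y)\<close>
    from below for the rotated direction \<nu>. It equals \<epsilon>' at 0, so by continuity a whole
    arc of directions keeps the separation \<open>\<epsilon>' / 2\<close>.\<close>
  have "((\<lambda>\<theta>. cos \<theta> * \<epsilon>' - \<bar>sin \<theta>\<bar> * K) \<longlongrightarrow> cos 0 * \<epsilon>' - \<bar>sin 0\<bar> * K) (nhds (0::real))"
    by (intro tendsto_intros filterlim_ident)
  then have "eventually (\<lambda>\<theta>. \<epsilon>' / 2 < cos \<theta> * \<epsilon>' - \<bar>sin \<theta>\<bar> * K) (nhds (0::real))"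
    using \<epsilon>' by (intro order_tendstoD(1)) auto
  then obtain \<eta> where \<eta>: "0 < \<eta>" "\<And>\<theta>. \<bar>\<theta>\<bar> < \<eta> \<Longrightarrow> \<epsilon>' / 2 < cos \<theta> * \<epsilon>' - \<bar>sin \<theta>\<bar> * K"
    unfolding eventually_nhds_metric by (auto simp: dist_real_def)
  have far: "(\<Sum>i\<in>S. c i * integral (cbox (lo i) (lo i + h))
        (\<lambda>y. exp (- \<i> * of_real (k * ((cos \<theta> *\<^sub>R A + sin \<theta> *\<^sub>R B) \<bullet> y))))) = 0"
    if \<theta>: "\<bar>\<theta>\<bar> < \<eta>" for \<theta>
  proof (rule far_field_zero)
    let ?\<nu> = "cos \<theta> *\<^sub>R A + sin \<theta> *\<^sub>R B"
    show \<nu>: "norm ?\<nu> = 1"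
      by (simp add: norm_eq_1 inner_add_left inner_add_right orth unit flip: power2_eq_square)
    show "\<epsilon>' / 2 \<le> ?\<nu> \<bullet> (x - y)" if iy: "i \<in> S" "y \<in> cbox (lo i) (lo i + h)" for i y
    proof -
      have "0 \<le> \<bar>sin \<theta>\<bar> * K" using K by simp
      then have "0 < cos \<theta> * \<epsilon>'"
        using \<eta>(2)[OF \<theta>] \<epsilon>' by linarith
      then have "0 < cos \<theta>"
        using \<epsilon>' zero_less_mult_pos2 by blast
      then have "cos \<theta> * \<epsilon>' \<le> cos \<theta> * (A \<bullet> (x - y))"
        using A[OF iy] by simp
      moreover have "\<bar>sin \<theta> * (B \<bullet> (x - y))\<bar> \<le> \<bar>sin \<theta>\<bar> * K"
      proof -
        have "\<bar>B \<bullet> (x - y)\<bar> \<le> norm B * norm (x - y)"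
          by (rule Cauchy_Schwarz_ineq2)
        also have "\<dots> \<le> K"
          using K(2)[OF iy] unit(2) by (simp add: norm_eq_1[symmetric])
        finally show ?thesis
          by (simp add: abs_mult mult_left_mono)
      qed
      ultimately show ?thesis
        using \<eta>(2)[OF \<theta>] by (simp add: inner_add_left)
    qed
    show "(\<Sum>i\<in>S. c i * integral (cbox (lo i) (lo i + h)) (green k (x + t *\<^sub>R ?\<nu>))) = 0"
      if "0 < t" "t < r" for t
      using that \<nu> by (intro zero) (simp add: dist_norm)
  qed (use S r \<epsilon>' in auto)
  \<comment> \<open>The choice \<open>\<tau> = arsinh (\<sigma> / k)\<close> turns
    \<open>k sinh \<tau>\<close> into the free growth parameter \<sigma>; then \<kappa> is the wave
    number \<open>k cosh \<tau>\<close> of the oscillating factor.\<close>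
  define \<kappa> where "\<kappa> \<sigma> = k * cosh (arsinh (\<sigma> / k))" for \<sigma>
  define lam where "lam \<sigma> b = of_real (\<sigma> * (B \<bullet> b)) - \<i> * of_real (\<kappa> \<sigma> * (A \<bullet> b))" for \<sigma> b
  define E where "E \<sigma> y = exp (of_real (\<sigma> * (B \<bullet> y)) - \<i> * of_real (\<kappa> \<sigma> * (A \<bullet> y)))" for \<sigma> y
  \<comment> \<open>This character property is what separates the corner from the reference box
    \<open>cbox 0 h\<close> in each cell integral.\<close>
  have E_add: "E \<sigma> (y + z) = E \<sigma> y * E \<sigma> z" for \<sigma> y z
    unfolding E_def by (simp add: inner_add_right algebra_simps flip: exp_add)
  have E_Basis: "E \<sigma> y = exp (\<Sum>b\<in>Basis. lam \<sigma> b * of_real (y \<bullet> b))" for \<sigma> y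
  proof -
    have *: "C \<bullet> y = (\<Sum>b\<in>Basis. (C \<bullet> b) * (y \<bullet> b))" for C
      by (rule euclidean_inner)
    show ?thesis
      unfolding E_def lam_def *[of A] *[of B]
      by (simp add: sum_distrib_left sum_subtractf algebra_simps)
  qed
  have B: "B \<bullet> d \<noteq> 0" if "d \<in> F" for d
    using w(1) w(3)[OF that] by (simp add: B_def)
  have lead: "(\<Sum>i\<in>S. c i * E \<sigma> (lo i)) = 0" if \<sigma>: "0 < \<sigma>" for \<sigma>
  proof -
    have sh: "k * sinh (arsinh (\<sigma> / k)) = \<sigma>"
      using k by simp
    have "(\<Sum>i\<in>S. c i * integral (cbox (lo i) (lo i + h)) (E \<sigma>)) = 0"
      using far_field_complexify[where \<tau> = "arsinh (\<sigma> / k)", OF \<eta>(1) far]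
      unfolding sh E_def \<kappa>_def by simp
    moreover have "integral (cbox (lo i) (lo i + h)) (E \<sigma>) = E \<sigma> (lo i) * integral (cbox 0 h) (E \<sigma>)" for i
    proof -
      have "integral (cbox (lo i) (lo i + h)) (E \<sigma>) = integral (cbox 0 h) (E \<sigma> \<circ> (+) (lo i))"
        using integral_shift_cbox_plus[of 0 h "E \<sigma>" "lo i"] by (simp add: add.commute)
      then show ?thesis
        by (simp add: o_def E_add)
    qed
    ultimately have "(\<Sum>i\<in>S. c i * E \<sigma> (lo i)) * integral (cbox 0 h) (E \<sigma>) = 0"
      by (simp add: sum_distrib_right mult.assoc)
    moreover have "integral (cbox 0 h) (E \<sigma>) \<noteq> 0"
    proof -
      have "Re (lam \<sigma> b) \<noteq> 0" if "b \<in> Basis" for b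
        using \<sigma> B[of b] that by (simp add: lam_def F_def)
      then show ?thesis
        using integral_cbox_exp_linear_nonzero[of "lam \<sigma>" h] hB by (simp flip: E_Basis)
    qed
    ultimately show ?thesis by simp
  qed
  show ?thesis
  proof (rule exponential_sum_coeffs_zero[OF S(1) _ _ lead i])
    show "inj_on (\<lambda>i. B \<bullet> lo i) S"
    proof (rule inj_onI, rule ccontr)
      fix i j assume "i \<in> S" "j \<in> S" "B \<bullet> lo i = B \<bullet> lo j" "i \<noteq> j"
      then have "lo i - lo j \<in> F"
        unfolding F_def by (intro UnI1 image_eqI[of _ _ "(i, j)"]) auto
      from B[OF this] \<open>B \<bullet> lo i = B \<bullet> lo j\<close> show False
        by (simp add: inner_diff_right)
    qed
    show "norm (E \<sigma> (lo i)) = exp (\<sigma> * (B \<bullet> lo i))" for \<sigma> i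
      by (simp add: E_def)
  qed
qed

section \<open>The cells of the partition and the potential of a piecewise constant density\<close>

definition cell_corner :: "real^3 \<Rightarrow> real^3 \<Rightarrow> nat \<Rightarrow> nat^3 \<Rightarrow> real^3" where
  "cell_corner a b n I = (\<chi> j. grid_node a b n j (I $ j))"

text \<open>The grid is uniform, so the side vector does not depend on the index; this is the common
  \<open>h\<close> of the translated boxes.\<close>

definition cell_size :: "real^3 \<Rightarrow> real^3 \<Rightarrow> nat \<Rightarrow> real^3" where
  "cell_size a b n = (\<chi> j. (b $ j - a $ j) / real n)"

lemma cell_eq_box:
  "cell a b n I = box (cell_corner a b n I) (cell_corner a b n I + cell_size a b n)"
  by (auto simp: cell_def cell_corner_def cell_size_def mem_box_cart grid_node_def algebra_simps add_divide_distrib diff_divide_distrib)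

lemma closed_cell_subset:
  assumes "\<And>j. a $ j < b $ j" "I \<in> multi_indices n"
  shows "cbox (cell_corner a b n I) (cell_corner a b n I + cell_size a b n) \<subseteq> cbox a b"
proof -
  have node: "a $ j \<le> grid_node a b n j (I $ j)"
    "grid_node a b n j (I $ j) + (b $ j - a $ j) / real n \<le> b $ j" for j
  proof -
    have I: "real (I $ j) + 1 \<le> real n" and n: "0 < real n"
    proof -
      have "I $ j + 1 \<le> n"
        using assms(2) by (simp add: multi_indices_def Suc_le_eq)
      then show "real (I $ j) + 1 \<le> real n" "0 < real n"
        by linarith+
    qed
    then show "a $ j \<le> grid_node a b n j (I $ j)"
      using assms(1)[of j] by (simp add: grid_node_def)
    \<comment> \<open>The upper node of a cell has index \<open>I $ j + 1\<close>, at most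
      \<open>n\<close>, and node \<open>n\<close> is \<open>b $ j\<close>.\<close>
    have "(b $ j - a $ j) / real n * (real (I $ j) + 1) \<le> (b $ j - a $ j) / real n * real n"
      using assms(1)[of j] I n by (intro mult_left_mono) auto
    then show "grid_node a b n j (I $ j) + (b $ j - a $ j) / real n \<le> b $ j"
      using n by (simp add: grid_node_def distrib_left)
  qed
  show ?thesis
    using node by (auto simp: mem_box_cart cell_corner_def cell_size_def) (meson order_trans)+
qed

lemma inj_cell_corner:
  assumes "\<And>j. a $ j < b $ j" "n \<ge> 1"
  shows "inj (cell_corner a b n)"
proof (rule injI)
  fix I I' assume "cell_corner a b n I = cell_corner a b n I'"
  then have eq: "grid_node a b n j (I $ j) = grid_node a b n j (I' $ j)" for j
    by (simp add: cell_corner_def vec_eq_iff)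
  have "I $ j = I' $ j" for j
    using eq[of j] assms(1)[of j] assms(2) by (simp add: grid_node_def)
  then show "I = I'"
    by (simp add: vec_eq_iff)
qed

text \<open>Off the closed box the kernel is continuous in \<open>y\<close>, hence integrable over
  every cell, and linearity applies. Passing from open to closed cells changes only a null set and
  brings the integrals into the form used for the holomorphic argument.\<close>

lemma potential_piecewise_constant:
  assumes "\<And>j. a $ j < b $ j" "x \<notin> cbox a b"
  shows "(LINT y:box a b|lborel. green k x y * (\<Sum>I\<in>multi_indices n. c I * indicator (cell a b n I) y)) =
    (\<Sum>I\<in>multi_indices n. c I *
      integral (cbox (cell_corner a b n I) (cell_corner a b n I + cell_size a b n)) (green k x))"
proof -
  have int: "set_integrable lborel (cell a b n I) (green k x)"
    and cell: "cell a b n I \<subseteq> box a b" if "I \<in> multi_indices n" for I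
  proof -
    have "set_integrable lborel (cbox a b) (green k x)"
      unfolding set_integrable_def green_def
      using assms(2) by (intro borel_integrable_compact continuous_intros) auto
    moreover have sub: "cell a b n I \<subseteq> cbox a b"
      using closed_cell_subset[OF assms(1) that] box_subset_cbox unfolding cell_eq_box by blast
    ultimately show "set_integrable lborel (cell a b n I) (green k x)"
      by (intro set_integrable_subset[of lborel "cbox a b" "green k x" "cell a b n I"]) (simp_all add: cell_eq_box)
    \<comment> \<open>An open cell inside the closed box lies in its interior, so the indicator of
      the open box is 1 on each cell.\<close>
    have "interior (cell a b n I) \<subseteq> interior (cbox a b)"
      using sub by (rule interior_mono)
    then show "cell a b n I \<subseteq> box a b"
      by (simp add: interior_cbox cell_eq_box interior_open[OF open_box])
  qed
  have "(LINT y:box a b|lborel. green k x y * (\<Sum>I\<in>multi_indices n. c I * indicator (cell a b n I) y)) =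
    (LINT y|lborel. (\<Sum>I\<in>multi_indices n. c I * (indicator (cell a b n I) y *\<^sub>R green k x y)))"
    unfolding set_lebesgue_integral_def
  proof (intro Bochner_Integration.integral_cong refl)
    fix y
    have "indicator (box a b) y *\<^sub>R (green k x y * (\<Sum>I\<in>multi_indices n. c I * indicator (cell a b n I) y)) =
      (\<Sum>I\<in>multi_indices n. indicator (box a b) y *\<^sub>R (green k x y * (c I * indicator (cell a b n I) y)))"
      by (simp add: sum_distrib_left scaleR_sum_right)
    also have "\<dots> = (\<Sum>I\<in>multi_indices n. c I * (indicator (cell a b n I) y *\<^sub>R green k x y))"
      using cell by (intro sum.cong refl) (auto simp: indicator_def)
    finally show "indicator (box a b) y *\<^sub>R (green k x y * (\<Sum>I\<in>multi_indices n. c I * indicator (cell a b n I) y)) = \<dots>" .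
  qed
  also have "\<dots> = (\<Sum>I\<in>multi_indices n. c I * (LINT y:cell a b n I|lborel. green k x y))"
    using int unfolding set_integrable_def set_lebesgue_integral_def
    by (subst Bochner_Integration.integral_sum) (simp_all del: mult_scaleR_right)
  also have "\<dots> = (\<Sum>I\<in>multi_indices n. c I *
      integral (cbox (cell_corner a b n I) (cell_corner a b n I + cell_size a b n)) (green k x))"
    using int by (intro sum.cong refl)
      (simp add: set_borel_integral_eq_integral(2) cell_eq_box integral_open_interval)
  finally show ?thesis .
qed

theorem theorem5:
  fixes a b :: "real^3" and n :: nat and k0 l :: real
    and P D :: "(real^3) set" and u J :: "real^3 \<Rightarrow> complex"
  assumes "\<And>j. a $ j < b $ j"
    and "P = box a b"
    and "n \<ge> 1"
    and "open D" and "connected D" and "D \<noteq> {}" and "bounded D"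
    and "closure D \<inter> closure P = {}"
    and "smooth_on_closure D u"
    and "l = Min (range (\<lambda>j. \<bar>b $ j - a $ j\<bar>))"
    and "k0 > 0"
    and "k0 > pi ^ 2 * real n ^ 3 / (2 * l)"
    and "J \<in> piecewise_constant a b n"
    and "solves_first_kind k0 P D u J"
  shows "\<forall>J'. J' \<in> piecewise_constant a b n \<and> solves_first_kind k0 P D u J' \<longrightarrow> J' = J"
proof (intro allI impI, elim conjE)
  fix J' assume J': "J' \<in> piecewise_constant a b n" "solves_first_kind k0 P D u J'"
  obtain c where c: "J = (\<lambda>x. \<Sum>I\<in>multi_indices n. c I * indicator (cell a b n I) x)"
    using assms(13) by (auto simp: piecewise_constant_def)
  obtain c' where c': "J' = (\<lambda>x. \<Sum>I\<in>multi_indices n. c' I * indicator (cell a b n I) x)"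
    using J'(1) by (auto simp: piecewise_constant_def)
  let ?lo = "cell_corner a b n" and ?h = "cell_size a b n"
  \<comment> \<open>Nonemptiness is needed for the closure of the open box to be
    \<open>cbox a b\<close>; then disjointness of the closures keeps \<open>D\<close> off the closed
    box.\<close>
  have "box a b \<noteq> {}"
    using assms(1) by (simp add: interval_ne_empty_cart)
  then have out: "x \<notin> cbox a b" if "x \<in> D" for x
    using that assms(2,8) closure_subset[of D] by (auto simp: closure_box)
  have zero: "(\<Sum>I\<in>multi_indices n. (c' I - c I) * integral (cbox (?lo I) (?lo I + ?h)) (green k0 z)) = 0"
    if "z \<in> D" for z
  proof -
    have "(LINT y:box a b|lborel. green k0 z y * J' y) = (LINT y:box a b|lborel. green k0 z y * J y)"
      using that assms(2,14) J'(2) by (simp add: solves_first_kind_def)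
    then show ?thesis
      unfolding c c' potential_piecewise_constant[OF assms(1) out[OF that]]
      by (simp add: left_diff_distrib sum_subtractf)
  qed
  obtain x where "x \<in> D"
    using assms(6) by blast
  then obtain r where r: "0 < r" "ball x r \<subseteq> D"
    using assms(4) open_contains_ball by blast
  \<comment> \<open>Strict separation of a point from a closed convex set. The gap
    \<open>\<beta> - v \<bullet> x\<close> serves as \<epsilon>, and the normal used below is
    \<open>- v\<close>, which points from the box towards \<open>x\<close>, so that the rays lead
    away from the box.\<close>
  obtain v \<beta> where v: "v \<bullet> x < \<beta>" "\<And>y. y \<in> cbox a b \<Longrightarrow> \<beta> < v \<bullet> y"
    using separating_hyperplane_closed_point[of "cbox a b" x] out[OF \<open>x \<in> D\<close>] by auto
  have eq: "c' I = c I" if I: "I \<in> multi_indices n" for I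
  proof -
    have "c' I - c I = 0"
    proof (rule density_zero_if_potential_zero[OF finite_multi_indices _ _ assms(11) _ _ r(1) _ I])
      show "inj_on ?lo (multi_indices n)"
        using inj_cell_corner[OF assms(1,3)] by (rule inj_on_subset) simp
      show "0 < ?h $ j" for j
        using assms(1)[of j] assms(3) by (simp add: cell_size_def)
      show "0 < \<beta> - v \<bullet> x"
        using v(1) by simp
      show "\<beta> - v \<bullet> x \<le> (- v) \<bullet> (x - y)" if "I \<in> multi_indices n" "y \<in> cbox (?lo I) (?lo I + ?h)" for I y
        using v(2)[of y] closed_cell_subset[OF assms(1) that(1)] that(2)
        by (auto simp: inner_diff_right)
    qed (use zero r in auto)
    then show ?thesis by simp
  qed
  show "J' = J"
    unfolding c c' using eq by simp
qed

end
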